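(* Let $n\ge 1$ and let $({\bf d}_1,{\bf v}_1)$ and $({\bf d}_2,{\bf v}_2)$ be elements of $\Theta_{CH_n}^{can}$. Then $({\bf d}_1,{\bf v}_1)\sim_{sys}({\bf d}_2,{\bf v}_2)$ if and only if $({\bf d}_1,{\bf v}_1)$ and $({\bf d}_2,{\bf v}_2)$ lie in the same orbit of the $(S_n\rtimes_\phi\mathbb{T}^n)$-action.
   Context: $\Theta_{CH_n}=\{({\bf d},{\bf v}):{\bf d}=(d_1,\dots,d_n)^T\in\mathbb{R}^n,\ d_i>0,\ {\bf v}=(v_1,\dots,v_{2n})^T\in\mathbb{R}^{2n}\}$, and $$\Theta_{CH_n}^{can}=\{({\bf d},{\bf v})\in\Theta_{CH_n}: d_1,\dots,d_n\text{ pairwise distinct and } v_l^2+v_{n+l}^2>0\text{ for all }l=1,\dots,n\}.$$ Controllable Hamiltonian systems and $\sim_{sys}$. For $({\bf d},{\bf v})\in\Theta_{CH_n}$ let $a_0,\dots,a_{2n-1}$ be defined by $\lambda^{2n}+\sum_{i=0}^{2n-1}a_i\lambda^i=\prod_{i=1}^n(\lambda^2+d_i^2)$. Let $g_1^{ctr}({\bf d})$ be the $2n\times2n$ companion matrix with ones on the first superdiagonal, last row $(-a_0,-a_1,\dots,-a_{2n-1})$, and zeros elsewhere. Let $g_2^{ctr}({\bf d},{\bf v})=\begin{bmatrix}0&c_{2n-1}&0&c_{2n-3}&\cdots&0&c_1\end{bmatrix}$, where for $k=0,\dots,n-1$, $c_{2k+1}={\bf v}^T\begin{bmatrix}F_k&0\\0&F_k\end{bmatrix}{\bf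 v}$, $F_k=\mathrm{diag}(f_1,\dots,f_n)$, $f_l=d_l\sum_{1\le j_1<\dots<j_k\le n,\ j_1,\dots,j_k\neq l}(d_{j_1}\cdots d_{j_k})^2$ (the sum is $1$ for $k=0$). The system $\theta_{CH_n}({\bf d},{\bf v})$ is $\dot{\bf s}=g_1^{ctr}({\bf d}){\bf s}+(0,\dots,0,1)^Tu$, $y=g_2^{ctr}({\bf d},{\bf v}){\bf s}$ on $\mathbb{R}^{2n}$. One writes $({\bf d}_1,{\bf v}_1)\sim_{sys}({\bf d}_2,{\bf v}_2)$ if $\theta_{CH_n}({\bf d}_1,{\bf v}_1)$ and $\theta_{CH_n}({\bf d}_2,{\bf v}_2)$ are linearly system isomorphic, i.e. there is an invertible real $2n\times 2n$ matrix $L$ with $Lg_1^{ctr}({\bf d}_1)=g_1^{ctr}({\bf d}_2)L$, $L(0,\dots,0,1)^T=(0,\dots,0,1)^T$ and $g_2^{ctr}({\bf d}_1,{\bf v}_1)=g_2^{ctr}({\bf d}_2,{\bf v}_2)L$. Group action. For $\sigma\in S_n$ let $P_\sigma$ be the permutation matrix with $P_\sigma(x_1,\dots,x_n)^T=(x_{\sigma(1)},\dots,x_{\sigma(n)})^T$, and for $\theta=(\theta_1,\dots,\theta_n)^T\in\mathbb{T}^n$ let $$R_\theta=\begin{bmatrix}\mathrm{diag}(\cos\theta_i)&-\mathrm{diag}(\sin\theta_i)\\ \mathrm{diag}(\sin\theta_i)&\mathrm{diag}(\cos\theta_i)\end{bmatrix}.$$ The semi-direct product $S_n\rtimes_\phi\mathbb{T}^n$,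 with $\phi(\sigma)(\theta)=P_\sigma\theta$, acts on $\Theta_{CH_n}$ by $$\Gamma_{(\sigma,\theta)}({\bf d},{\bf v})=\left(P_\sigma{\bf d},\ R_\theta\begin{bmatrix}P_\sigma&0\\0&P_\sigma\end{bmatrix}{\bf v}\right),$$ where the product of $S_n$ is taken so that $P_{\sigma\bar\sigma}=P_\sigma P_{\bar\sigma}$. *)

theory Defs
  imports
    "Jordan_Normal_Form.Matrix"
    "HOL-Computational_Algebra.Polynomial"
    "HOL-Combinatorics.Permutations"
    "HOL-Algebra.Group_Action"
    "HOL-Library.Real_Mod"
begin

text \<open>
  All indices start at 0: the entries \<open>d\<^sub>1, \<dots>, d\<^sub>n\<close> are \<open>d $ 0, \<dots>, d $ (n - 1)\<close>, and
  \<open>v\<^sub>l\<close>, \<open>v\<^bsub>n+l\<^esub>\<close> become \<open>v $ l\<close>, \<open>v $ (n + l)\<close> for \<open>l < n\<close>.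
\<close>

section \<open>Parameter spaces\<close>

definition Theta :: "nat \<Rightarrow> (real vec \<times> real vec) set" where
  "Theta n = {(d, v). d \<in> carrier_vec n \<and> (\<forall>i<n. d $ i > 0) \<and> v \<in> carrier_vec (2 * n)}"

definition Theta_can :: "nat \<Rightarrow> (real vec \<times> real vec) set" where
  "Theta_can n = {(d, v) \<in> Theta n. inj_on (\<lambda>i. d $ i) {..<n} \<and>
     (\<forall>l<n. (v $ l)\<^sup>2 + (v $ (n + l))\<^sup>2 > 0)}"

definition block_diag2 :: "nat \<Rightarrow> real mat \<Rightarrow> real mat" where
  "block_diag2 n A = four_block_mat A (0\<^sub>m n n) (0\<^sub>m n n) A"


section \<open>Controllable Hamiltonian systems\<close>

text \<open>A linear system \<open>(A, B, C)\<close> stands for \<open>s' = A s + B u\<close>, \<open>y = C s\<close>.\<close>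

type_synonym linear_system = "real mat \<times> real mat \<times> real mat"

definition linear_system_iso :: "nat \<Rightarrow> linear_system \<Rightarrow> linear_system \<Rightarrow> bool" where
  "linear_system_iso N = (\<lambda>(A\<^sub>1, B\<^sub>1, C\<^sub>1) (A\<^sub>2, B\<^sub>2, C\<^sub>2).
     \<exists>L \<in> carrier_mat N N. invertible_mat L \<and> L * A\<^sub>1 = A\<^sub>2 * L \<and> L * B\<^sub>1 = B\<^sub>2 \<and> C\<^sub>1 = C\<^sub>2 * L)"

definition ham_poly :: "nat \<Rightarrow> real vec \<Rightarrow> real poly" where
  "ham_poly n d = (\<Prod>i<n. [:(d $ i)\<^sup>2, 0, 1:])"

definition g1_ctr :: "nat \<Rightarrow> real vec \<Rightarrow> real mat" where
  "g1_ctr n d = mat (2 * n) (2 * n) (\<lambda>(i, j).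
     if i = 2 * n - 1 then - coeff (ham_poly n d) j else if j = i + 1 then 1 else 0)"

definition input_ctr :: "nat \<Rightarrow> real mat" where
  "input_ctr n = mat (2 * n) 1 (\<lambda>(i, j). if i = 2 * n - 1 then 1 else 0)"

text \<open>The sum over \<open>j\<^sub>1 < \<dots> < j\<^sub>k\<close> avoiding \<open>l\<close> is a sum over \<open>k\<close>-element sets \<open>J\<close> of indices.\<close>

definition f_coeff :: "nat \<Rightarrow> real vec \<Rightarrow> nat \<Rightarrow> nat \<Rightarrow> real" where
  "f_coeff n d k l =
     d $ l * (\<Sum>J | J \<subseteq> {..<n} - {l} \<and> card J = k. (\<Prod>j\<in>J. d $ j)\<^sup>2)"

definition F_mat :: "nat \<Rightarrow> real vec \<Rightarrow> nat \<Rightarrow> real mat" where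
  "F_mat n d k = mat_diag n (f_coeff n d k)"

text \<open>\<open>c_odd n d v k\<close> is the coefficient \<open>c\<^bsub>2k+1\<^esub>\<close>.\<close>

definition c_odd :: "nat \<Rightarrow> real vec \<Rightarrow> real vec \<Rightarrow> nat \<Rightarrow> real" where
  "c_odd n d v k = v \<bullet> (block_diag2 n (F_mat n d k) *\<^sub>v v)"

text \<open>
  In the row \<open>(0, c\<^bsub>2n-1\<^esub>, 0, c\<^bsub>2n-3\<^esub>, \<dots>, 0, c\<^sub>1)\<close> the entry at an odd position \<open>j = 2m + 1\<close>
  (counted from 0) is \<open>c\<^bsub>2n-j\<^esub> = c\<^bsub>2(n-1-m)+1\<^esub>\<close>.
\<close>

definition g2_ctr :: "nat \<Rightarrow> real vec \<Rightarrow> real vec \<Rightarrow> real mat" where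
  "g2_ctr n d v = mat 1 (2 * n) (\<lambda>(i, j).
     if odd j then c_odd n d v (n - 1 - j div 2) else 0)"

definition theta_CH :: "nat \<Rightarrow> real vec \<times> real vec \<Rightarrow> linear_system" where
  "theta_CH n = (\<lambda>(d, v). (g1_ctr n d, input_ctr n, g2_ctr n d v))"

definition sys_equiv :: "nat \<Rightarrow> real vec \<times> real vec \<Rightarrow> real vec \<times> real vec \<Rightarrow> bool" where
  "sys_equiv n p q \<longleftrightarrow> linear_system_iso (2 * n) (theta_CH n p) (theta_CH n q)"


section \<open>The group and its action\<close>

definition perm_mat :: "nat \<Rightarrow> (nat \<Rightarrow> nat) \<Rightarrow> real mat" where
  "perm_mat n \<sigma> = mat n n (\<lambda>(i, j). if j = \<sigma> i then 1 else 0)"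

text \<open>
  The product is composition in reverse order, so that
  \<open>perm_mat n (\<sigma> \<otimes> \<tau>) = perm_mat n \<sigma> * perm_mat n \<tau>\<close> (proved below).
\<close>

definition perm_group :: "nat \<Rightarrow> (nat \<Rightarrow> nat) monoid" where
  "perm_group n = \<lparr>carrier = {\<sigma>. \<sigma> permutes {..<n}}, mult = (\<lambda>\<sigma> \<tau>. \<tau> \<circ> \<sigma>), one = id\<rparr>"

text \<open>The torus: angles modulo \<open>2\<pi>\<close>, represented in \<open>[0, 2\<pi>)\<close>.\<close>

definition torus_group :: "nat \<Rightarrow> real vec monoid" where
  "torus_group n =
     \<lparr>carrier = {\<theta> \<in> carrier_vec n. \<forall>i<n. 0 \<le> \<theta> $ i \<and> \<theta> $ i < 2 * pi},
      mult = (\<lambda>\<theta> \<eta>. vec n (\<lambda>i. (\<theta> $ i + \<eta> $ i) rmod (2 * pi))),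
      one = 0\<^sub>v n\<rparr>"

definition semidirect_prod ::
  "('a, 'm) monoid_scheme \<Rightarrow> ('b, 'n) monoid_scheme \<Rightarrow> ('a \<Rightarrow> 'b \<Rightarrow> 'b) \<Rightarrow> ('a \<times> 'b) monoid" where
  "semidirect_prod H N \<phi> =
     \<lparr>carrier = carrier H \<times> carrier N,
      mult = (\<lambda>(h, k) (h', k'). (h \<otimes>\<^bsub>H\<^esub> h', k \<otimes>\<^bsub>N\<^esub> \<phi> h k')),
      one = (\<one>\<^bsub>H\<^esub>, \<one>\<^bsub>N\<^esub>)\<rparr>"

definition sym_torus_group :: "nat \<Rightarrow> ((nat \<Rightarrow> nat) \<times> real vec) monoid" where
  "sym_torus_group n =
     semidirect_prod (perm_group n) (torus_group n) (\<lambda>\<sigma> \<theta>. perm_mat n \<sigma> *\<^sub>v \<theta>)"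

definition rot_mat :: "nat \<Rightarrow> real vec \<Rightarrow> real mat" where
  "rot_mat n \<theta> = four_block_mat
     (mat_diag n (\<lambda>i. cos (\<theta> $ i))) (- mat_diag n (\<lambda>i. sin (\<theta> $ i)))
     (mat_diag n (\<lambda>i. sin (\<theta> $ i))) (mat_diag n (\<lambda>i. cos (\<theta> $ i)))"

text \<open>The restriction to \<open>Theta n\<close> is the extensionality convention of \<^locale>\<open>group_action\<close>.\<close>

definition Gam :: "nat \<Rightarrow> (nat \<Rightarrow> nat) \<times> real vec \<Rightarrow> real vec \<times> real vec \<Rightarrow> real vec \<times> real vec" where
  "Gam n = (\<lambda>(\<sigma>, \<theta>). \<lambda>(d, v) \<in> Theta n.
     (perm_mat n \<sigma> *\<^sub>v d, rot_mat n \<theta> *\<^sub>v (block_diag2 n (perm_mat n \<sigma>) *\<^sub>v v)))"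


section \<open>The action is a group action\<close>

lemma perm_mat_carrier [simp]: "perm_mat n \<sigma> \<in> carrier_mat n n"
  by (simp add: perm_mat_def)

lemma perm_mat_mult_vec:
  assumes "\<sigma> permutes {..<n}" "x \<in> carrier_vec n"
  shows "perm_mat n \<sigma> *\<^sub>v x = vec n (\<lambda>i. x $ \<sigma> i)"
proof (rule eq_vecI)
  fix i assume i: "i < dim_vec (vec n (\<lambda>i. x $ \<sigma> i))"
  hence "\<sigma> i < n" using permutes_in_image[OF assms(1), of i] by simp
  have "(\<Sum>j = 0..<n. (if j = \<sigma> i then 1 else 0) * x $ j) =
      (\<Sum>j = 0..<n. if j = \<sigma> i then x $ j else 0)"
    by (intro sum.cong) auto
  also have "\<dots> = x $ \<sigma> i" using \<open>\<sigma> i < n\<close> by simp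
  finally have "(\<Sum>j = 0..<n. (if j = \<sigma> i then 1 else 0) * x $ j) = x $ \<sigma> i" .
  thus "(perm_mat n \<sigma> *\<^sub>v x) $ i = vec n (\<lambda>i. x $ \<sigma> i) $ i"
    using i carrier_vecD[OF assms(2)] by (simp add: perm_mat_def scalar_prod_def)
qed (simp add: perm_mat_def)

lemma perm_mat_mult:
  assumes "\<sigma> permutes {..<n}" "\<tau> permutes {..<n}"
  shows "perm_mat n (\<sigma> \<otimes>\<^bsub>perm_group n\<^esub> \<tau>) = perm_mat n \<sigma> * perm_mat n \<tau>"
proof (rule eq_matI)
  fix i j assume "i < dim_row (perm_mat n \<sigma> * perm_mat n \<tau>)"
    and "j < dim_col (perm_mat n \<sigma> * perm_mat n \<tau>)"
  hence i: "i < n" and j: "j < n" by (auto simp: perm_mat_def)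
  have s: "\<sigma> i < n" using i permutes_in_image[OF assms(1), of i] by simp
  have "(perm_mat n \<sigma> * perm_mat n \<tau>) $$ (i, j) =
      (\<Sum>m = 0..<n. (if m = \<sigma> i then 1 else 0) * (if j = \<tau> m then 1 else 0))"
    using i j by (simp add: perm_mat_def scalar_prod_def)
  also have "\<dots> = (if j = \<tau> (\<sigma> i) then 1 else 0)"
    using s by (simp add: if_distrib[of "\<lambda>c. c * _"] cong: if_cong)
  finally show "perm_mat n (\<sigma> \<otimes>\<^bsub>perm_group n\<^esub> \<tau>) $$ (i, j) = (perm_mat n \<sigma> * perm_mat n \<tau>) $$ (i, j)"
    using i j by (simp add: perm_mat_def perm_group_def)
qed (auto simp: perm_mat_def)

lemma block_diag2_perm:
  assumes \<sigma>: "\<sigma> permutes {..<n}" and v: "v \<in> carrier_vec (2 * n)"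
  shows "block_diag2 n (perm_mat n \<sigma>) *\<^sub>v v =
    vec (2 * n) (\<lambda>i. if i < n then v $ \<sigma> i else v $ (n + \<sigma> (i - n)))"
proof (rule eq_vecI)
  fix i assume "i < dim_vec (vec (2 * n) (\<lambda>i. if i < n then v $ \<sigma> i else v $ (n + \<sigma> (i - n))))"
  hence i: "i < 2 * n" by simp
  define m where "m = (if i < n then \<sigma> i else n + \<sigma> (i - n))"
  have m: "m < 2 * n"
    using permutes_in_image[OF \<sigma>, of i] permutes_in_image[OF \<sigma>, of "i - n"] i
    by (auto simp: m_def)
  have "(block_diag2 n (perm_mat n \<sigma>) *\<^sub>v v) $ i =
      (\<Sum>j = 0..<2 * n. block_diag2 n (perm_mat n \<sigma>) $$ (i, j) * v $ j)"
    using i v by (auto simp: block_diag2_def perm_mat_def scalar_prod_def intro!: sum.cong)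
  also have "\<dots> = (\<Sum>j = 0..<2 * n. if j = m then v $ j else 0)"
  proof (rule sum.cong)
    fix j assume j: "j \<in> {0..<2 * n}"
    have "block_diag2 n (perm_mat n \<sigma>) $$ (i, j) = (if j = m then 1 else 0)"
      using i j permutes_in_image[OF \<sigma>, of i] permutes_in_image[OF \<sigma>, of "i - n"]
      by (auto simp: block_diag2_def perm_mat_def m_def)
    thus "block_diag2 n (perm_mat n \<sigma>) $$ (i, j) * v $ j = (if j = m then v $ j else 0)"
      by simp
  qed simp
  also have "\<dots> = v $ m" using m by simp
  finally show "(block_diag2 n (perm_mat n \<sigma>) *\<^sub>v v) $ i =
      vec (2 * n) (\<lambda>i. if i < n then v $ \<sigma> i else v $ (n + \<sigma> (i - n))) $ i"
    using i by (simp add: m_def)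
qed (simp add: block_diag2_def perm_mat_def)

lemma rot_mat_mult_vec:
  assumes v: "v \<in> carrier_vec (2 * n)"
  shows "rot_mat n \<theta> *\<^sub>v v = vec (2 * n) (\<lambda>i.
    if i < n then cos (\<theta> $ i) * v $ i - sin (\<theta> $ i) * v $ (n + i)
    else sin (\<theta> $ (i - n)) * v $ (i - n) + cos (\<theta> $ (i - n)) * v $ i)"
    (is "_ = vec _ ?f")
proof (rule eq_vecI)
  fix i assume "i < dim_vec (vec (2 * n) ?f)"
  hence i: "i < 2 * n" by simp
  define m where "m = (if i < n then i else i - n)"
  have m: "m < n" using i by (auto simp: m_def)
  define a where "a = (if i < n then cos (\<theta> $ m) else sin (\<theta> $ m))"
  define b where "b = (if i < n then - sin (\<theta> $ m) else cos (\<theta> $ m))"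
  have "(rot_mat n \<theta> *\<^sub>v v) $ i = (\<Sum>j = 0..<2 * n. rot_mat n \<theta> $$ (i, j) * v $ j)"
    using i v by (auto simp: rot_mat_def mat_diag_def scalar_prod_def intro!: sum.cong)
  also have "\<dots> = (\<Sum>j = 0..<2 * n.
      (if j = m then a * v $ j else 0) + (if j = n + m then b * v $ j else 0))"
  proof (rule sum.cong)
    fix j assume j: "j \<in> {0..<2 * n}"
    have "rot_mat n \<theta> $$ (i, j) = (if j = m then a else 0) + (if j = n + m then b else 0)"
      using i j by (auto simp: rot_mat_def mat_diag_def m_def a_def b_def)
    thus "rot_mat n \<theta> $$ (i, j) * v $ j =
        (if j = m then a * v $ j else 0) + (if j = n + m then b * v $ j else 0)"
      by (simp add: algebra_simps)
  qed simp
  also have "\<dots> = a * v $ m + b * v $ (n + m)"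
    using m by (simp add: sum.distrib)
  finally show "(rot_mat n \<theta> *\<^sub>v v) $ i = vec (2 * n) ?f $ i"
    using i by (auto simp: m_def a_def b_def)
qed (simp add: rot_mat_def mat_diag_def)

lemma Gam_apply:
  assumes \<sigma>: "\<sigma> permutes {..<n}" and dv: "(d, v) \<in> Theta n"
  shows "Gam n (\<sigma>, \<theta>) (d, v) = (vec n (\<lambda>i. d $ \<sigma> i), vec (2 * n) (\<lambda>i.
    if i < n then cos (\<theta> $ i) * v $ \<sigma> i - sin (\<theta> $ i) * v $ (n + \<sigma> i)
    else sin (\<theta> $ (i - n)) * v $ \<sigma> (i - n) + cos (\<theta> $ (i - n)) * v $ (n + \<sigma> (i - n))))"
proof -
  have d: "d \<in> carrier_vec n" and v: "v \<in> carrier_vec (2 * n)"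
    using dv by (auto simp: Theta_def)
  show ?thesis
    using dv by (auto simp: Gam_def perm_mat_mult_vec[OF \<sigma> d] block_diag2_perm[OF \<sigma> v]
        rot_mat_mult_vec intro!: eq_vecI)
qed

lemma Gam_in_Theta:
  assumes \<sigma>: "\<sigma> permutes {..<n}" and x: "x \<in> Theta n"
  shows "Gam n (\<sigma>, \<theta>) x \<in> Theta n"
proof -
  obtain d v where dv: "x = (d, v)" "(d, v) \<in> Theta n" using x by (cases x) auto
  have "\<sigma> i < n" if "i < n" for i using permutes_in_image[OF \<sigma>, of i] that by simp
  thus ?thesis using dv(2) unfolding dv(1) Gam_apply[OF \<sigma> dv(2)] by (auto simp: Theta_def)
qed

lemma cos_rmod_2pi [simp]: "cos (x rmod (2 * pi)) = cos x"
  and sin_rmod_2pi [simp]: "sin (x rmod (2 * pi)) = sin x"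
proof -
  have "x rmod (2 * pi) = x - 2 * pi * of_int \<lfloor>x / (2 * pi)\<rfloor>"
    by (simp add: rmod_def)
  thus "cos (x rmod (2 * pi)) = cos x" "sin (x rmod (2 * pi)) = sin x"
    by (simp_all add: cos_diff sin_diff)
qed

lemmas trig_rmod_2pi [simp] =
  cos_rmod_2pi[unfolded mult.commute[of 2 pi]] sin_rmod_2pi[unfolded mult.commute[of 2 pi]]

lemma group_perm_group: "group (perm_group n)"
proof (rule groupI)
  fix \<sigma> assume "\<sigma> \<in> carrier (perm_group n)"
  thus "\<exists>\<tau>\<in>carrier (perm_group n). \<tau> \<otimes>\<^bsub>perm_group n\<^esub> \<sigma> = \<one>\<^bsub>perm_group n\<^esub>"
    by (intro bexI[of _ "inv_into UNIV \<sigma>"])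
       (auto simp: perm_group_def permutes_inv permutes_inv_o)
qed (auto simp: perm_group_def permutes_compose permutes_id comp_assoc)

lemma group_torus_group: "group (torus_group n)"
proof (rule groupI)
  fix \<theta> assume \<theta>: "\<theta> \<in> carrier (torus_group n)"
  have "(((- \<theta> $ i) rmod (2 * pi)) + \<theta> $ i) rmod (2 * pi) = 0" if "i < n" for i
  proof -
    have "\<theta> $ i rmod (2 * pi) = \<theta> $ i"
      using \<theta> that by (auto simp: torus_group_def)
    thus ?thesis using rmod_add[of "- \<theta> $ i" "2 * pi" "\<theta> $ i"] by simp
  qed
  thus "\<exists>\<eta>\<in>carrier (torus_group n). \<eta> \<otimes>\<^bsub>torus_group n\<^esub> \<theta> = \<one>\<^bsub>torus_group n\<^esub>"
    by (intro bexI[of _ "vec n (\<lambda>i. (- \<theta> $ i) rmod (2 * pi))"])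
       (auto simp: torus_group_def rmod_nonneg rmod_less intro!: eq_vecI)
next
  fix x y z assume c: "x \<in> carrier (torus_group n)" "y \<in> carrier (torus_group n)"
    "z \<in> carrier (torus_group n)"
  have "((x $ i + y $ i) rmod (2 * pi) + z $ i) rmod (2 * pi) =
      (x $ i + (y $ i + z $ i) rmod (2 * pi)) rmod (2 * pi)" if "i < n" for i
    using rmod_add[of "x $ i + y $ i" "2 * pi" "z $ i"]
      rmod_add[of "x $ i" "2 * pi" "y $ i + z $ i"] c that
    by (simp add: torus_group_def add.assoc)
  thus "x \<otimes>\<^bsub>torus_group n\<^esub> y \<otimes>\<^bsub>torus_group n\<^esub> z = x \<otimes>\<^bsub>torus_group n\<^esub> (y \<otimes>\<^bsub>torus_group n\<^esub> z)"
    by (auto simp: torus_group_def intro!: eq_vecI)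
qed (auto simp: torus_group_def rmod_nonneg rmod_less intro!: eq_vecI)

lemma group_sym_torus_group: "group (sym_torus_group n)"
proof -
  interpret H: group "perm_group n" by (rule group_perm_group)
  interpret N: group "torus_group n" by (rule group_torus_group)
  let ?\<phi> = "\<lambda>\<sigma> \<theta>. perm_mat n \<sigma> *\<^sub>v \<theta>"
  have perm: "\<sigma> permutes {..<n}" if "\<sigma> \<in> carrier (perm_group n)" for \<sigma>
    using that by (simp add: perm_group_def)
  have less: "\<sigma> i < n" if "\<sigma> \<in> carrier (perm_group n)" "i < n" for \<sigma> i
    using permutes_in_image[OF perm[OF that(1)], of i] that(2) by simp
  have ap: "?\<phi> \<sigma> \<theta> = vec n (\<lambda>i. \<theta> $ \<sigma> i)"
    if "\<sigma> \<in> carrier (perm_group n)" "\<theta> \<in> carrier (torus_group n)" for \<sigma> \<theta>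
    using perm_mat_mult_vec[OF perm[OF that(1)]] that(2) by (simp add: torus_group_def)
  have closed: "?\<phi> \<sigma> \<theta> \<in> carrier (torus_group n)"
    if "\<sigma> \<in> carrier (perm_group n)" "\<theta> \<in> carrier (torus_group n)" for \<sigma> \<theta>
    unfolding ap[OF that] using less[OF that(1)] that(2) by (auto simp: torus_group_def)
  have add: "?\<phi> \<sigma> (\<theta> \<otimes>\<^bsub>torus_group n\<^esub> \<eta>) = ?\<phi> \<sigma> \<theta> \<otimes>\<^bsub>torus_group n\<^esub> ?\<phi> \<sigma> \<eta>"
    if "\<sigma> \<in> carrier (perm_group n)" "\<theta> \<in> carrier (torus_group n)" "\<eta> \<in> carrier (torus_group n)" for \<sigma> \<theta> \<eta>
    unfolding ap[OF that(1) N.m_closed[OF that(2,3)]] ap[OF that(1,2)] ap[OF that(1,3)]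
    using less[OF that(1)] by (auto simp: torus_group_def intro!: eq_vecI)
  have comp: "?\<phi> (\<sigma> \<otimes>\<^bsub>perm_group n\<^esub> \<tau>) \<theta> = ?\<phi> \<sigma> (?\<phi> \<tau> \<theta>)"
    if "\<sigma> \<in> carrier (perm_group n)" "\<tau> \<in> carrier (perm_group n)" "\<theta> \<in> carrier (torus_group n)" for \<sigma> \<tau> \<theta>
    unfolding ap[OF H.m_closed[OF that(1,2)] that(3)] ap[OF that(1) closed[OF that(2,3)]]
    unfolding ap[OF that(2,3)]
    using less[OF that(1)] by (auto simp: perm_group_def intro!: eq_vecI)
  have one: "?\<phi> \<one>\<^bsub>perm_group n\<^esub> \<theta> = \<theta>" if "\<theta> \<in> carrier (torus_group n)" for \<theta>
    unfolding ap[OF H.one_closed that] using that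
    by (auto simp: perm_group_def torus_group_def intro!: eq_vecI)
  show ?thesis
  proof (rule groupI)
    fix x assume "x \<in> carrier (sym_torus_group n)"
    then obtain \<sigma> \<theta> where x: "x = (\<sigma>, \<theta>)" "\<sigma> \<in> carrier (perm_group n)" "\<theta> \<in> carrier (torus_group n)"
      by (auto simp: sym_torus_group_def semidirect_prod_def)
    let ?s = "inv\<^bsub>perm_group n\<^esub> \<sigma>"
    show "\<exists>y\<in>carrier (sym_torus_group n). y \<otimes>\<^bsub>sym_torus_group n\<^esub> x = \<one>\<^bsub>sym_torus_group n\<^esub>"
      using x closed[of ?s \<theta>]
      by (intro bexI[of _ "(?s, inv\<^bsub>torus_group n\<^esub> (?\<phi> ?s \<theta>))"])
         (auto simp: sym_torus_group_def semidirect_prod_def)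
  qed (auto simp: sym_torus_group_def semidirect_prod_def closed add comp one H.m_assoc N.m_assoc)
qed

theorem group_action_Gam: "group_action (sym_torus_group n) (Theta n) (Gam n)"
proof -
  interpret G: group "sym_torus_group n" by (rule group_sym_torus_group)
  have mem: "\<exists>\<sigma> \<theta>. g = (\<sigma>, \<theta>) \<and> \<sigma> permutes {..<n} \<and> \<theta> \<in> carrier_vec n"
    if "g \<in> carrier (sym_torus_group n)" for g
    using that by (auto simp: sym_torus_group_def semidirect_prod_def perm_group_def torus_group_def)
  have closed: "Gam n g x \<in> Theta n" if "g \<in> carrier (sym_torus_group n)" "x \<in> Theta n" for g x
    using mem[OF that(1)] Gam_in_Theta that(2) by blast
  have comp: "Gam n (g \<otimes>\<^bsub>sym_torus_group n\<^esub> h) x = Gam n g (Gam n h x)"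
    if g: "g \<in> carrier (sym_torus_group n)" and h: "h \<in> carrier (sym_torus_group n)"
      and x: "x \<in> Theta n" for g h x
  proof -
    obtain \<sigma> \<theta> where gp: "g = (\<sigma>, \<theta>)" "\<sigma> permutes {..<n}" "\<theta> \<in> carrier_vec n" using mem[OF g] by blast
    obtain \<tau> \<eta> where hp: "h = (\<tau>, \<eta>)" "\<tau> permutes {..<n}" "\<eta> \<in> carrier_vec n" using mem[OF h] by blast
    obtain d v where dv: "x = (d, v)" "(d, v) \<in> Theta n" using x by (cases x) auto
    have gh: "g \<otimes>\<^bsub>sym_torus_group n\<^esub> h =
        (\<tau> \<circ> \<sigma>, vec n (\<lambda>i. (\<theta> $ i + \<eta> $ \<sigma> i) rmod (2 * pi)))"
      using gp hp perm_mat_mult_vec[OF gp(2) hp(3)]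
      by (auto simp: sym_torus_group_def semidirect_prod_def perm_group_def torus_group_def intro!: eq_vecI)
    have less: "\<sigma> i < n" if "i < n" for i using permutes_in_image[OF gp(2), of i] that by simp
    have less2: "\<sigma> i < n * 2" if "i < n" for i using less[OF that] by simp
    have in': "Gam n h x \<in> Theta n" using closed[OF h x] .
    show ?thesis
      using in' less less2
      unfolding gh unfolding gp(1) hp(1) dv(1) Gam_apply[OF hp(2) dv(2)]
        Gam_apply[OF permutes_compose[OF gp(2) hp(2)] dv(2)]
      by (subst Gam_apply[OF gp(2)])
         (auto simp: cos_add sin_add algebra_simps intro!: eq_vecI)
  qed
  have one: "Gam n \<one>\<^bsub>sym_torus_group n\<^esub> x = x" if x: "x \<in> Theta n" for x
  proof -
    obtain d v where dv: "x = (d, v)" "(d, v) \<in> Theta n" using x by (cases x) auto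
    have o: "\<one>\<^bsub>sym_torus_group n\<^esub> = (id, 0\<^sub>v n)"
      by (simp add: sym_torus_group_def semidirect_prod_def perm_group_def torus_group_def)
    show ?thesis
      using dv(2) unfolding o dv(1) Gam_apply[OF permutes_id dv(2)]
      by (auto simp: Theta_def intro!: eq_vecI)
  qed
  have bij: "Gam n g \<in> Bij (Theta n)" if g: "g \<in> carrier (sym_torus_group n)" for g
  proof -
    have "bij_betw (Gam n g) (Theta n) (Theta n)"
      by (rule bij_betw_byWitness[where f' = "Gam n (inv\<^bsub>sym_torus_group n\<^esub> g)"])
         (use g in \<open>simp_all add: comp[symmetric] one image_subset_iff closed del: split_paired_All split_paired_all\<close>)
    moreover have "Gam n g \<in> extensional (Theta n)"
      by (cases g) (simp add: Gam_def)
    ultimately show ?thesis by (simp add: Bij_def)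
  qed
  have "Gam n (g \<otimes>\<^bsub>sym_torus_group n\<^esub> h) = compose (Theta n) (Gam n g) (Gam n h)"
    if g: "g \<in> carrier (sym_torus_group n)" and h: "h \<in> carrier (sym_torus_group n)" for g h
  proof (rule extensionalityI[of _ "Theta n"])
    show "Gam n (g \<otimes>\<^bsub>sym_torus_group n\<^esub> h) \<in> extensional (Theta n)"
      using bij[of "g \<otimes>\<^bsub>sym_torus_group n\<^esub> h"] g h by (simp add: Bij_def)
  qed (auto simp: comp g h compose_eq)
  hence "Gam n \<in> hom (sym_torus_group n) (BijGroup (Theta n))"
    by (auto simp: hom_def BijGroup_def bij)
  thus ?thesis
    by (intro group_action.intro group_hom.intro group_hom_axioms.intro
        group_sym_torus_group group_BijGroup)
qed

end

theory Submission
  imports Defs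
begin

text \<open>
  An intertwiner of two controllable forms that fixes the input vector is a Toeplitz matrix whose
  last column is a unit vector, hence it is the identity. So equivalent systems have equal
  matrices, i.e. the rational functions
  \<open>\<Sum>l. d\<^sub>l (v\<^sub>l\<^sup>2 + v\<^bsub>n+l\<^esub>\<^sup>2) / (y + d\<^sub>l\<^sup>2)\<close> of \<open>y = s\<^sup>2\<close> have the same denominator and
  numerator. As the \<open>d\<^sub>l\<close> are distinct and positive, poles and residues determine the pairs
  \<open>(d\<^sub>l, v\<^sub>l\<^sup>2 + v\<^bsub>n+l\<^esub>\<^sup>2)\<close> up to order, and rotations act transitively on the vectors
  \<open>(v\<^sub>l, v\<^bsub>n+l\<^esub>)\<close> of a given norm.
\<close>

section \<open>Coefficients of products of monic linear polynomials\<close>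

text \<open>Vieta's formula: expanding the product, \<open>J\<close> is the set of factors that
  contribute their constant term. It ties the sums over \<open>J\<close> in \<open>f_coeff\<close>
  to polynomial coefficients.\<close>

lemma coeff_prod_monic_linear:
  fixes a :: "'b \<Rightarrow> 'a :: comm_ring_1"
  assumes A: "finite A" and k: "k \<le> card A"
  shows "coeff (\<Prod>j\<in>A. [:a j, 1:]) (card A - k) = (\<Sum>J | J \<subseteq> A \<and> card J = k. \<Prod>j\<in>J. a j)"
proof -
  have const: "(\<Prod>j\<in>J. [:a j:]) = [:\<Prod>j\<in>J. a j:]" for J
    by (induction J rule: infinite_finite_induct) auto
  have "(\<Prod>j\<in>A. [:a j, 1:]) = (\<Prod>j\<in>A. [:a j:] + monom 1 1)"
    by (simp add: monom_altdef)
  also have "\<dots> = (\<Sum>J\<in>Pow A. monom (\<Prod>j\<in>J. a j) (card A - card J))"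
    unfolding prod_add[OF A]
    by (intro sum.cong)
       (auto simp: const smult_monom monom_power card_Diff_subset finite_subset[OF _ A])
  finally have "coeff (\<Prod>j\<in>A. [:a j, 1:]) (card A - k) =
      (\<Sum>J\<in>Pow A. if card A - card J = card A - k then \<Prod>j\<in>J. a j else 0)"
    by (simp add: coeff_sum)
  \<comment> \<open>Both \<open>card J\<close> and \<open>k\<close> are at most
    \<open>card A\<close>, so the truncated differences agree only if
    \<open>card J = k\<close>.\<close>
  also have "\<dots> = (\<Sum>J\<in>Pow A. if card J = k then \<Prod>j\<in>J. a j else 0)"
  proof (rule sum.cong)
    fix J assume "J \<in> Pow A"
    hence "card J \<le> card A" using A by (auto intro: card_mono)
    thus "(if card A - card J = card A - k then \<Prod>j\<in>J. a j else 0) =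
        (if card J = k then \<Prod>j\<in>J. a j else 0)"
      using k by auto
  qed simp
  also have "\<dots> = (\<Sum>J | J \<subseteq> A \<and> card J = k. \<Prod>j\<in>J. a j)"
    using A by (simp add: sum.If_cases Pow_def Collect_conj_eq)
  finally show ?thesis .
qed

lemma poly_prod_monic_linear:
  fixes a :: "'b \<Rightarrow> 'a :: comm_ring_1"
  shows "poly (\<Prod>j\<in>A. [:a j, 1:]) y = (\<Prod>j\<in>A. a j + y)"
  by (simp add: poly_prod)

lemma degree_prod_monic_linear_le:
  fixes a :: "'b \<Rightarrow> 'a :: idom"
  shows "degree (\<Prod>j\<in>A. [:a j, 1:]) \<le> card A"
proof (cases "finite A")
  case True
  thus ?thesis using degree_prod_sum_le[of A "\<lambda>j. [:a j, 1:]"] by (simp add: o_def)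
qed simp

section \<open>Isomorphisms of controllable forms\<close>

lemma g1_ctr_carrier [simp]: "g1_ctr n d \<in> carrier_mat (2 * n) (2 * n)"
  and input_ctr_carrier [simp]: "input_ctr n \<in> carrier_mat (2 * n) 1"
  and g2_ctr_carrier [simp]: "g2_ctr n d v \<in> carrier_mat 1 (2 * n)"
  by (simp_all add: g1_ctr_def input_ctr_def g2_ctr_def)

text \<open>Multiplying by the companion matrix on the right shifts the columns and adds multiples
  of the last column, since only its last row goes beyond the superdiagonal.\<close>

lemma index_mult_g1_ctr:
  assumes L: "L \<in> carrier_mat (2 * n) (2 * n)" and i: "i < 2 * n" and j: "j < 2 * n"
  shows "(L * g1_ctr n d) $$ (i, j) =
    (if j = 0 then 0 else L $$ (i, j - 1)) +
    L $$ (i, 2 * n - 1) * g1_ctr n d $$ (2 * n - 1, j)"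
proof -
  let ?g = "g1_ctr n d"
  have "(L * ?g) $$ (i, j) = (\<Sum>k = 0..<2 * n. L $$ (i, k) * ?g $$ (k, j))"
    using L i j by (auto simp: g1_ctr_def scalar_prod_def intro!: sum.cong)
  also have "\<dots> = (\<Sum>k = 0..<2 * n. (if j \<noteq> 0 \<and> k = j - 1 then L $$ (i, k) else 0) +
      (if k = 2 * n - 1 then L $$ (i, k) * ?g $$ (k, j) else 0))"
    by (rule sum.cong) (use j in \<open>auto simp: g1_ctr_def\<close>)
  also have "\<dots> = (if j = 0 then 0 else L $$ (i, j - 1)) + L $$ (i, 2 * n - 1) * ?g $$ (2 * n - 1, j)"
    using i j by (auto simp: sum.distrib)
  finally show ?thesis .
qed

lemma index_g1_ctr_mult:
  assumes L: "L \<in> carrier_mat (2 * n) (2 * n)" and i: "Suc i < 2 * n" and j: "j < 2 * n"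
  shows "(g1_ctr n d * L) $$ (i, j) = L $$ (Suc i, j)"
proof -
  have "(g1_ctr n d * L) $$ (i, j) = (\<Sum>k = 0..<2 * n. g1_ctr n d $$ (i, k) * L $$ (k, j))"
    using L i j by (auto simp: g1_ctr_def scalar_prod_def intro!: sum.cong)
  also have "\<dots> = (\<Sum>k = 0..<2 * n. if k = Suc i then L $$ (k, j) else 0)"
    by (rule sum.cong) (use i in \<open>auto simp: g1_ctr_def\<close>)
  also have "\<dots> = L $$ (Suc i, j)" using i by simp
  finally show ?thesis .
qed

lemma index_mult_input_ctr:
  assumes L: "L \<in> carrier_mat (2 * n) (2 * n)" and i: "i < 2 * n"
  shows "(L * input_ctr n) $$ (i, 0) = L $$ (i, 2 * n - 1)"
proof -
  have "(L * input_ctr n) $$ (i, 0) = (\<Sum>k = 0..<2 * n. if k = 2 * n - 1 then L $$ (i, k) else 0)"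
    using L i by (auto simp: input_ctr_def scalar_prod_def if_distrib intro!: sum.cong cong: if_cong)
  thus ?thesis using i by simp
qed

lemma ctr_intertwiner_eq_one:
  assumes L: "L \<in> carrier_mat (2 * n) (2 * n)"
    and A: "L * g1_ctr n d1 = g1_ctr n d2 * L" and B: "L * input_ctr n = input_ctr n"
  shows "L = 1\<^sub>m (2 * n)"
proof -
  have last: "L $$ (i, 2 * n - 1) = (if i = 2 * n - 1 then 1 else 0)" if "i < 2 * n" for i
    using index_mult_input_ctr[OF L that] that unfolding B by (simp add: input_ctr_def)
  \<comment> \<open>In a row other than the last, the last entry of \<open>L\<close> is 0, so the
    characteristic coefficients drop out and only the two shifts remain.\<close>
  have step: "L $$ (Suc i, j) = (if j = 0 then 0 else L $$ (i, j - 1))"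
    if "Suc i < 2 * n" "j < 2 * n" for i j
    using index_mult_g1_ctr[OF L, of i j d1] index_g1_ctr_mult[OF L that, of d2] last[of i] that
    unfolding A by simp
  have toeplitz: "L $$ (i, j) = (if i \<le> j then L $$ (0, j - i) else 0)"
    if "i < 2 * n" "j < 2 * n" for i j
    using that
  proof (induction i arbitrary: j)
    case (Suc i)
    have "L $$ (Suc i, j) = (if j = 0 then 0 else L $$ (i, j - 1))" using step Suc.prems by simp
    also have "\<dots> = (if Suc i \<le> j then L $$ (0, j - Suc i) else 0)"
      using Suc.IH[of "j - 1"] Suc.prems by auto
    finally show ?case .
  qed simp
  \<comment> \<open>The diagonal starting at column \<open>m\<close> of row 0 meets the known last
    column in row \<open>2 * n - 1 - m\<close>.\<close>
  have first: "L $$ (0, m) = (if m = 0 then 1 else 0)" if m: "m < 2 * n" for m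
  proof -
    define k where "k = 2 * n - 1 - m"
    have k: "k < 2 * n" "2 * n - 1 < 2 * n" "k \<le> 2 * n - 1" "2 * n - 1 - k = m"
      and k_last: "k = 2 * n - 1 \<longleftrightarrow> m = 0"
      using m by (auto simp: k_def)
    have "L $$ (0, m) = L $$ (k, 2 * n - 1)"
      unfolding toeplitz[OF k(1,2)] k(4) if_P[OF k(3)] ..
    also have "\<dots> = (if m = 0 then 1 else 0)"
      unfolding last[OF k(1)] k_last ..
    finally show ?thesis .
  qed
  show ?thesis
  proof (rule eq_matI)
    fix i j assume "i < dim_row (1\<^sub>m (2 * n) :: real mat)" "j < dim_col (1\<^sub>m (2 * n) :: real mat)"
    thus "L $$ (i, j) = 1\<^sub>m (2 * n) $$ (i, j)"
      using toeplitz[of i j] first[of "j - i"] by auto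
  qed (use L in auto)
qed

lemma sys_equiv_iff_eq:
  "sys_equiv n (d1, v1) (d2, v2) \<longleftrightarrow> g1_ctr n d1 = g1_ctr n d2 \<and> g2_ctr n d1 v1 = g2_ctr n d2 v2"
proof
  assume "sys_equiv n (d1, v1) (d2, v2)"
  then obtain L where L: "L \<in> carrier_mat (2 * n) (2 * n)" "L * g1_ctr n d1 = g1_ctr n d2 * L"
    "L * input_ctr n = input_ctr n" "g2_ctr n d1 v1 = g2_ctr n d2 v2 * L"
    by (auto simp: sys_equiv_def theta_CH_def linear_system_iso_def)
  have "L = 1\<^sub>m (2 * n)" by (rule ctr_intertwiner_eq_one[OF L(1-3)])
  thus "g1_ctr n d1 = g1_ctr n d2 \<and> g2_ctr n d1 v1 = g2_ctr n d2 v2"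
    using L(2,4) left_mult_one_mat[OF g1_ctr_carrier] right_mult_one_mat[OF g1_ctr_carrier]
      right_mult_one_mat[OF g2_ctr_carrier] by metis
next
  assume "g1_ctr n d1 = g1_ctr n d2 \<and> g2_ctr n d1 v1 = g2_ctr n d2 v2"
  moreover have "invertible_mat (1\<^sub>m (2 * n) :: real mat)"
    unfolding invertible_mat_def inverts_mat_def by (intro conjI exI[of _ "1\<^sub>m (2 * n)"]) auto
  ultimately show "sys_equiv n (d1, v1) (d2, v2)"
    unfolding sys_equiv_def theta_CH_def linear_system_iso_def
    by (auto simp: left_mult_one_mat[OF g1_ctr_carrier] right_mult_one_mat[OF g1_ctr_carrier]
        right_mult_one_mat[OF g2_ctr_carrier] left_mult_one_mat[OF input_ctr_carrier]
        intro!: bexI[of _ "1\<^sub>m (2 * n)"])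
qed

section \<open>The denominator of the transfer function\<close>

text \<open>The characteristic polynomial in the variable \<open>y = s^2\<close>; its roots are the
  real numbers \<open>- (d $ j)^2\<close>.\<close>

definition freq_poly :: "nat \<Rightarrow> real vec \<Rightarrow> real poly" where
  "freq_poly n d = (\<Prod>j<n. [:(d $ j)\<^sup>2, 1:])"

lemma poly_freq_poly: "poly (freq_poly n d) y = (\<Prod>j<n. (d $ j)\<^sup>2 + y)"
  by (simp add: freq_poly_def poly_prod_monic_linear)

lemma poly_ham_poly: "poly (ham_poly n d) x = poly (freq_poly n d) (x\<^sup>2)"
  by (simp add: ham_poly_def poly_freq_poly poly_prod power2_eq_square)

text \<open>Substituting \<open>x^2\<close> tests \<open>freq_poly\<close> only at nonnegative
  arguments, but infinitely many points determine a polynomial.\<close>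

lemma ham_poly_eq_iff: "ham_poly n d1 = ham_poly n d2 \<longleftrightarrow> freq_poly n d1 = freq_poly n d2"
proof
  assume eq: "ham_poly n d1 = ham_poly n d2"
  let ?p = "freq_poly n d1 - freq_poly n d2"
  have "poly ?p y = 0" if "y \<ge> 0" for y
    using poly_ham_poly[of n d1 "sqrt y"] poly_ham_poly[of n d2 "sqrt y"] eq that by simp
  hence "{0..} \<subseteq> {y. poly ?p y = 0}" by auto
  hence "infinite {y. poly ?p y = 0}" using infinite_Ici infinite_super by blast
  hence "?p = 0" using poly_roots_finite by blast
  thus "freq_poly n d1 = freq_poly n d2" by simp
next
  assume "freq_poly n d1 = freq_poly n d2"
  thus "ham_poly n d1 = ham_poly n d2"
    by (simp add: poly_eq_poly_eq_iff[symmetric] poly_ham_poly fun_eq_iff)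
qed

lemma degree_ham_poly: "degree (ham_poly n d) = 2 * n"
  unfolding ham_poly_def by (subst degree_prod_eq_sum_degree) auto

lemma lead_coeff_ham_poly: "coeff (ham_poly n d) (2 * n) = 1"
proof -
  have "lead_coeff (ham_poly n d) = 1" by (simp add: ham_poly_def lead_coeff_prod)
  thus ?thesis by (simp add: degree_ham_poly)
qed

text \<open>The last row shows the coefficients of \<open>ham_poly\<close> below degree
  \<open>2 * n\<close>; the remaining ones are those of any monic polynomial of that degree.\<close>

lemma g1_ctr_eq_iff:
  assumes "n \<ge> 1"
  shows "g1_ctr n d1 = g1_ctr n d2 \<longleftrightarrow> freq_poly n d1 = freq_poly n d2"
proof
  assume eq: "g1_ctr n d1 = g1_ctr n d2"
  have "coeff (ham_poly n d1) j = coeff (ham_poly n d2) j" for j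
  proof (cases j "2 * n" rule: linorder_cases)
    case less
    hence "g1_ctr n d $$ (2 * n - 1, j) = - coeff (ham_poly n d) j" for d
      by (simp add: g1_ctr_def)
    thus ?thesis using eq by (metis neg_equal_iff_equal)
  next
    case equal
    thus ?thesis by (simp add: lead_coeff_ham_poly)
  next
    case greater
    thus ?thesis by (simp add: coeff_eq_0 degree_ham_poly)
  qed
  thus "freq_poly n d1 = freq_poly n d2" by (simp add: ham_poly_eq_iff[symmetric] poly_eqI)
next
  assume "freq_poly n d1 = freq_poly n d2"
  thus "g1_ctr n d1 = g1_ctr n d2" unfolding ham_poly_eq_iff[symmetric] g1_ctr_def by (rule arg_cong)
qed

section \<open>The numerator of the transfer function\<close>

definition weight :: "nat \<Rightarrow> real vec \<Rightarrow> nat \<Rightarrow> real" where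
  "weight n v l = (v $ l)\<^sup>2 + (v $ (n + l))\<^sup>2"

text \<open>The numerator of the sum of \<open>d $ l * weight n v l / (y + (d $ l)^2)\<close> over
  the common denominator \<open>freq_poly n d\<close>.\<close>

definition numer_poly :: "nat \<Rightarrow> real vec \<Rightarrow> real vec \<Rightarrow> real poly" where
  "numer_poly n d v =
    (\<Sum>l<n. smult (d $ l * weight n v l) (\<Prod>j\<in>{..<n} - {l}. [:(d $ j)\<^sup>2, 1:]))"

lemma block_diag2_mat_diag_mult_vec:
  assumes v: "v \<in> carrier_vec (2 * n)"
  shows "block_diag2 n (mat_diag n f) *\<^sub>v v = vec (2 * n) (\<lambda>i. f (if i < n then i else i - n) * v $ i)"
proof (rule eq_vecI)
  fix i assume "i < dim_vec (vec (2 * n) (\<lambda>i. f (if i < n then i else i - n) * v $ i))"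
  hence i: "i < 2 * n" by simp
  have "(block_diag2 n (mat_diag n f) *\<^sub>v v) $ i =
      (\<Sum>j = 0..<2 * n. block_diag2 n (mat_diag n f) $$ (i, j) * v $ j)"
    using i v by (auto simp: block_diag2_def mat_diag_def scalar_prod_def intro!: sum.cong)
  also have "\<dots> = (\<Sum>j = 0..<2 * n. if j = i then f (if i < n then i else i - n) * v $ j else 0)"
    by (rule sum.cong) (use i in \<open>auto simp: block_diag2_def mat_diag_def\<close>)
  finally show "(block_diag2 n (mat_diag n f) *\<^sub>v v) $ i =
      vec (2 * n) (\<lambda>i. f (if i < n then i else i - n) * v $ i) $ i"
    using i by simp
qed (simp add: block_diag2_def mat_diag_def)

text \<open>Both halves of \<open>v\<close> meet the same diagonal block, so the quadratic form sees
  \<open>v\<close> only through the rotation invariants \<open>weight\<close>.\<close>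

lemma c_odd_eq_sum:
  assumes v: "v \<in> carrier_vec (2 * n)"
  shows "c_odd n d v k = (\<Sum>l<n. f_coeff n d k l * weight n v l)"
proof -
  let ?t = "\<lambda>i. v $ i * (f_coeff n d k (if i < n then i else i - n) * v $ i)"
  have "c_odd n d v k = (\<Sum>i<2 * n. ?t i)"
    by (simp add: c_odd_def F_mat_def block_diag2_mat_diag_mult_vec[OF v] scalar_prod_def
        lessThan_atLeast0)
  also have "\<dots> = (\<Sum>i<n. ?t i) + (\<Sum>i<n. ?t (n + i))"
    by (simp add: mult_2 lessThan_atLeast0 sum.atLeastLessThan_concat[of 0 n "n + n", symmetric]
        sum.shift_bounds_nat_ivl[of _ 0 n n, simplified] add.commute)
  also have "\<dots> = (\<Sum>l<n. f_coeff n d k l * weight n v l)"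
    unfolding sum.distrib[symmetric]
    by (rule sum.cong) (auto simp: weight_def power2_eq_square algebra_simps)
  finally show ?thesis .
qed

text \<open>Vieta's formula applied to each summand, whose product runs over \<open>n - 1\<close>
  indices.\<close>

lemma coeff_numer_poly:
  assumes v: "v \<in> carrier_vec (2 * n)" and k: "k < n"
  shows "coeff (numer_poly n d v) (n - 1 - k) = c_odd n d v k"
proof -
  have "coeff (\<Prod>j\<in>{..<n} - {l}. [:(d $ j)\<^sup>2, 1:]) (n - 1 - k) =
      (\<Sum>J | J \<subseteq> {..<n} - {l} \<and> card J = k. (\<Prod>j\<in>J. d $ j)\<^sup>2)" if "l < n" for l
    using coeff_prod_monic_linear[of "{..<n} - {l}" k "\<lambda>j. (d $ j)\<^sup>2"] k that
    by (simp add: prod_power_distrib)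
  thus ?thesis
    by (simp add: numer_poly_def coeff_sum c_odd_eq_sum[OF v] f_coeff_def mult.assoc mult.commute
        mult.left_commute)
qed

lemma coeff_numer_poly_eq_0:
  assumes "i \<ge> n"
  shows "coeff (numer_poly n d v) i = 0"
proof -
  have "coeff (\<Prod>j\<in>{..<n} - {l}. [:(d $ j)\<^sup>2, 1:]) i = 0" if "l < n" for l
    using degree_prod_monic_linear_le[of "\<lambda>j. (d $ j)\<^sup>2" "{..<n} - {l}"] assms that
    by (intro coeff_eq_0) auto
  thus ?thesis by (simp add: numer_poly_def coeff_sum)
qed

lemma poly_numer_poly:
  "poly (numer_poly n d v) y =
    (\<Sum>l<n. d $ l * weight n v l * (\<Prod>j\<in>{..<n} - {l}. (d $ j)\<^sup>2 + y))"
  by (simp add: numer_poly_def poly_sum poly_prod_monic_linear)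

text \<open>Position \<open>2 * i + 1\<close> of the output row holds the coefficient of
  \<open>y^i\<close>: the row lists the coefficients of \<open>s\<close> times the numerator at
  \<open>s^2\<close>.\<close>

lemma g2_ctr_eq_iff:
  assumes v1: "v1 \<in> carrier_vec (2 * n)" and v2: "v2 \<in> carrier_vec (2 * n)"
  shows "g2_ctr n d1 v1 = g2_ctr n d2 v2 \<longleftrightarrow> numer_poly n d1 v1 = numer_poly n d2 v2"
proof
  assume eq: "g2_ctr n d1 v1 = g2_ctr n d2 v2"
  show "numer_poly n d1 v1 = numer_poly n d2 v2"
  proof (rule poly_eqI)
    fix i
    show "coeff (numer_poly n d1 v1) i = coeff (numer_poly n d2 v2) i"
    proof (cases "i < n")
      case True
      have "g2_ctr n d v $$ (0, 2 * i + 1) = coeff (numer_poly n d v) i"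
        if "v \<in> carrier_vec (2 * n)" for d v
        using coeff_numer_poly[OF that, of "n - 1 - i" d] True by (simp add: g2_ctr_def)
      thus ?thesis using eq v1 v2 by metis
    qed (simp add: coeff_numer_poly_eq_0)
  qed
next
  assume eq: "numer_poly n d1 v1 = numer_poly n d2 v2"
  have "c_odd n d1 v1 (n - 1 - j div 2) = c_odd n d2 v2 (n - 1 - j div 2)" if "j < 2 * n" for j
  proof -
    have k: "n - 1 - j div 2 < n" using that by simp
    show ?thesis using coeff_numer_poly[OF v1 k, of d1] coeff_numer_poly[OF v2 k, of d2] eq by simp
  qed
  thus "g2_ctr n d1 v1 = g2_ctr n d2 v2" by (auto simp: g2_ctr_def intro!: eq_matI)
qed

section \<open>Recovering the parameters up to permutation\<close>

text \<open>The roots determine the set of values of \<open>d\<close>, because positivity selects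
  one square root; two injective enumerations of one set differ by a permutation.\<close>

lemma freq_poly_eq_imp_perm:
  assumes d1: "\<And>i. i < n \<Longrightarrow> d1 $ i > 0" "inj_on (\<lambda>i. d1 $ i) {..<n}"
    and d2: "\<And>i. i < n \<Longrightarrow> d2 $ i > 0" "inj_on (\<lambda>i. d2 $ i) {..<n}"
    and eq: "freq_poly n d1 = freq_poly n d2"
  obtains \<sigma> where "\<sigma> permutes {..<n}" "\<And>i. i < n \<Longrightarrow> d2 $ i = d1 $ \<sigma> i"
proof -
  have root: "poly (freq_poly n d) (- x\<^sup>2) = 0 \<longleftrightarrow> x \<in> (\<lambda>i. d $ i) ` {..<n}"
    if "\<And>i. i < n \<Longrightarrow> d $ i > 0" "x > 0" for d x
  proof -
    have "(d $ i)\<^sup>2 = x\<^sup>2 \<longleftrightarrow> x = d $ i" if "i < n" for i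
      using \<open>x > 0\<close> \<open>\<And>i. i < n \<Longrightarrow> d $ i > 0\<close>[OF that] by (auto simp: power2_eq_iff)
    thus ?thesis by (auto simp: poly_freq_poly)
  qed
  have img: "(\<lambda>i. d1 $ i) ` {..<n} = (\<lambda>i. d2 $ i) ` {..<n}" (is "?D1 = ?D2")
  proof (rule Set.set_eqI)
    fix x
    have "x > 0" if "x \<in> ?D1 \<union> ?D2" using that d1(1) d2(1) by auto
    thus "x \<in> ?D1 \<longleftrightarrow> x \<in> ?D2" using root[of d1 x] root[of d2 x] d1(1) d2(1) eq by auto
  qed
  \<comment> \<open>\<open>\<sigma>\<close> sends \<open>i\<close> to the position of
    \<open>d2 $ i\<close> in \<open>d1\<close>; \<open>permutes\<close> requires the identity
    outside \<open>{..<n}\<close>.\<close>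
  define \<sigma> where "\<sigma> = (\<lambda>i. if i < n then inv_into {..<n} (\<lambda>i. d1 $ i) (d2 $ i) else i)"
  have "bij_betw (inv_into {..<n} (\<lambda>i. d1 $ i) \<circ> (\<lambda>i. d2 $ i)) {..<n} {..<n}"
    using bij_betw_inv_into[OF inj_on_imp_bij_betw[OF d1(2)]] inj_on_imp_bij_betw[OF d2(2)]
    unfolding img by (rule bij_betw_trans[rotated])
  hence "bij_betw \<sigma> {..<n} {..<n}"
    by (rule bij_betw_cong[THEN iffD1, rotated]) (simp add: \<sigma>_def)
  hence "\<sigma> permutes {..<n}" by (rule bij_imp_permutes) (simp add: \<sigma>_def)
  moreover have "d2 $ i = d1 $ \<sigma> i" if "i < n" for i
    using f_inv_into_f[of "d2 $ i" "\<lambda>i. d1 $ i" "{..<n}"] img that by (auto simp: \<sigma>_def)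
  ultimately show thesis using that by blast
qed

lemma prod_permuted:
  assumes \<sigma>: "\<sigma> permutes {..<n}" and d: "\<And>i. i < n \<Longrightarrow> d2 $ i = d1 $ \<sigma> i" and l: "l < n"
  shows "(\<Prod>j\<in>{..<n} - {l}. (d2 $ j)\<^sup>2 + y) = (\<Prod>j\<in>{..<n} - {\<sigma> l}. (d1 $ j)\<^sup>2 + y)"
proof -
  have "\<sigma> ` ({..<n} - {l}) = {..<n} - {\<sigma> l}"
    using permutes_image[OF \<sigma>] permutes_inj[OF \<sigma>] by (simp add: image_set_diff)
  moreover have "inj_on \<sigma> ({..<n} - {l})" using permutes_inj[OF \<sigma>] by (rule inj_on_subset) simp
  ultimately have "bij_betw \<sigma> ({..<n} - {l}) ({..<n} - {\<sigma> l})" by (simp add: bij_betw_def)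
  from prod.reindex_bij_betw[OF this, of "\<lambda>j. (d1 $ j)\<^sup>2 + y"] show ?thesis
    by (subst (asm) prod.cong[OF refl, of _ _ "\<lambda>j. (d2 $ j)\<^sup>2 + y"]) (simp_all add: d)
qed

text \<open>The weight at \<open>i\<close> is the residue at the pole \<open>- (d $ i)\<^sup>2\<close> up to a factor which depends on \<open>d\<close> only.\<close>

lemma poly_numer_poly_at_pole:
  assumes i: "i < n"
  shows "poly (numer_poly n d v) (- (d $ i)\<^sup>2) =
    d $ i * weight n v i * (\<Prod>j\<in>{..<n} - {i}. (d $ j)\<^sup>2 - (d $ i)\<^sup>2)"
proof -
  \<comment> \<open>For \<open>l \<noteq> i\<close> the factor with \<open>j = i\<close> is present
    and vanishes at the pole.\<close>
  have "(\<Prod>j\<in>{..<n} - {l}. (d $ j)\<^sup>2 + - (d $ i)\<^sup>2) = 0" if "l < n" "l \<noteq> i" for l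
    using i that by (intro prod_zero) auto
  hence "poly (numer_poly n d v) (- (d $ i)\<^sup>2) =
      (\<Sum>l<n. if l = i then d $ l * weight n v l * (\<Prod>j\<in>{..<n} - {l}. (d $ j)\<^sup>2 - (d $ i)\<^sup>2) else 0)"
    unfolding poly_numer_poly by (intro sum.cong) auto
  thus ?thesis using i by simp
qed

text \<open>From left to right, matching the poles gives \<open>\<sigma>\<close>, and evaluating the
  numerators at each pole gives the weights; from right to left, \<open>\<sigma>\<close> only
  reindexes products and sums.\<close>

lemma transfer_eq_iff_perm:
  assumes d1: "\<And>i. i < n \<Longrightarrow> d1 $ i > 0" "inj_on (\<lambda>i. d1 $ i) {..<n}"
    and d2: "\<And>i. i < n \<Longrightarrow> d2 $ i > 0" "inj_on (\<lambda>i. d2 $ i) {..<n}"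
  shows "freq_poly n d1 = freq_poly n d2 \<and> numer_poly n d1 v1 = numer_poly n d2 v2 \<longleftrightarrow>
    (\<exists>\<sigma>. \<sigma> permutes {..<n} \<and> (\<forall>i<n. d2 $ i = d1 $ \<sigma> i \<and> weight n v2 i = weight n v1 (\<sigma> i)))"
    (is "?lhs \<longleftrightarrow> ?rhs")
proof
  assume ?lhs
  hence freq: "freq_poly n d1 = freq_poly n d2" and numer: "numer_poly n d1 v1 = numer_poly n d2 v2"
    by auto
  from freq_poly_eq_imp_perm[OF d1 d2 freq] obtain \<sigma>
    where \<sigma>: "\<sigma> permutes {..<n}" and d: "\<And>i. i < n \<Longrightarrow> d2 $ i = d1 $ \<sigma> i" by blast
  have "weight n v2 i = weight n v1 (\<sigma> i)" if i: "i < n" for i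
  proof -
    let ?P = "\<Prod>j\<in>{..<n} - {i}. (d2 $ j)\<^sup>2 - (d2 $ i)\<^sup>2"
    have \<sigma>i: "\<sigma> i < n" using permutes_in_image[OF \<sigma>, of i] i by simp
    \<comment> \<open>The factors multiplying the weights agree at corresponding poles, so they can
      be cancelled once shown nonzero.\<close>
    have P: "?P = (\<Prod>j\<in>{..<n} - {\<sigma> i}. (d1 $ j)\<^sup>2 - (d2 $ i)\<^sup>2)"
      using prod_permuted[OF \<sigma> d i, of "- (d2 $ i)\<^sup>2"] by simp
    have "d2 $ i * weight n v1 (\<sigma> i) * ?P = poly (numer_poly n d1 v1) (- (d2 $ i)\<^sup>2)"
      unfolding P unfolding d[OF i] by (rule poly_numer_poly_at_pole[OF \<sigma>i, symmetric])
    also have "\<dots> = d2 $ i * weight n v2 i * ?P"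
      unfolding numer by (rule poly_numer_poly_at_pole[OF i])
    finally have "d2 $ i * weight n v1 (\<sigma> i) * ?P = d2 $ i * weight n v2 i * ?P" .
    \<comment> \<open>Positivity rules out \<open>d2 $ j = - d2 $ i\<close>, so distinct entries
      have distinct squares.\<close>
    moreover have "(d2 $ j)\<^sup>2 \<noteq> (d2 $ i)\<^sup>2" if "j < n" "j \<noteq> i" for j
      using d2(1)[OF i] d2(1)[OF that(1)] inj_onD[OF d2(2), of j i] i that
      by (auto simp: power2_eq_iff)
    hence "?P \<noteq> 0" by auto
    ultimately show ?thesis using d2(1)[OF i] by simp
  qed
  thus ?rhs using \<sigma> d by blast
next
  assume ?rhs
  then obtain \<sigma> where \<sigma>: "\<sigma> permutes {..<n}" and d: "\<And>i. i < n \<Longrightarrow> d2 $ i = d1 $ \<sigma> i"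
    and w: "\<And>i. i < n \<Longrightarrow> weight n v2 i = weight n v1 (\<sigma> i)" by blast
  have bij: "bij_betw \<sigma> {..<n} {..<n}" by (rule permutes_imp_bij[OF \<sigma>])
  have "freq_poly n d2 = (\<Prod>j<n. [:(d1 $ \<sigma> j)\<^sup>2, 1:])"
    unfolding freq_poly_def by (intro prod.cong) (use d in auto)
  also have "\<dots> = freq_poly n d1"
    unfolding freq_poly_def by (rule prod.reindex_bij_betw[OF bij])
  finally have "freq_poly n d1 = freq_poly n d2" ..
  moreover have "poly (numer_poly n d1 v1) y = poly (numer_poly n d2 v2) y" for y
  proof -
    have "poly (numer_poly n d2 v2) y =
        (\<Sum>l<n. d1 $ \<sigma> l * weight n v1 (\<sigma> l) * (\<Prod>j\<in>{..<n} - {\<sigma> l}. (d1 $ j)\<^sup>2 + y))"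
      unfolding poly_numer_poly by (intro sum.cong) (use d w prod_permuted[OF \<sigma> d] in auto)
    also have "\<dots> = poly (numer_poly n d1 v1) y"
      unfolding poly_numer_poly by (rule sum.reindex_bij_betw[OF bij])
    finally show ?thesis by simp
  qed
  ultimately show ?lhs by (simp add: poly_eq_poly_eq_iff[symmetric] fun_eq_iff)
qed

section \<open>Orbits\<close>

text \<open>Read the pairs as the complex numbers \<open>z = a + i b\<close> and
  \<open>w = c + i e\<close> of equal modulus. For \<open>z \<noteq> 0\<close> the quotient
  \<open>w / z\<close>, that is \<open>w\<close> times the conjugate of \<open>z\<close> over
  \<open>r\<close>, lies on the unit circle, and \<open>t\<close> is its argument.\<close>

lemma rotation_exists:
  fixes a b c e :: real
  assumes eq: "c\<^sup>2 + e\<^sup>2 = a\<^sup>2 + b\<^sup>2"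
  obtains t where "0 \<le> t" "t < 2 * pi" "c = cos t * a - sin t * b" "e = sin t * a + cos t * b"
proof (cases "a\<^sup>2 + b\<^sup>2 = 0")
  case True
  hence "a = 0" "b = 0" "c = 0" "e = 0" using eq by (auto simp: sum_power2_eq_zero_iff)
  thus ?thesis using that[of 0] by simp
next
  case False
  define r where "r = a\<^sup>2 + b\<^sup>2"
  have r: "r \<noteq> 0" using False by (simp add: r_def)
  \<comment> \<open>Multiplicativity of the squared modulus, for \<open>w\<close> times the
    conjugate of \<open>z\<close>.\<close>
  have "(a * c + b * e)\<^sup>2 + (a * e - b * c)\<^sup>2 = (a\<^sup>2 + b\<^sup>2) * (c\<^sup>2 + e\<^sup>2)"
    by (simp add: power2_eq_square algebra_simps)
  hence "((a * c + b * e) / r)\<^sup>2 + ((a * e - b * c) / r)\<^sup>2 = 1"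
    using r eq by (simp add: power_divide add_divide_distrib[symmetric] r_def power2_eq_square[of "_ + _"])
  then obtain t where t: "0 \<le> t" "t < 2 * pi" "(a * c + b * e) / r = cos t" "(a * e - b * c) / r = sin t"
    by (rule sincos_total_2pi)
  have cs: "cos t * r = a * c + b * e" "sin t * r = a * e - b * c"
    unfolding t(3,4)[symmetric] using r by simp_all
  have "c * r = (a * c + b * e) * a - (a * e - b * c) * b"
    "e * r = (a * e - b * c) * a + (a * c + b * e) * b"
    by (simp_all add: r_def power2_eq_square algebra_simps)
  moreover have "cos t * r * a - sin t * r * b = (cos t * a - sin t * b) * r"
    "sin t * r * a + cos t * r * b = (sin t * a + cos t * b) * r"
    by (simp_all add: algebra_simps)
  ultimately have "c * r = (cos t * a - sin t * b) * r" "e * r = (sin t * a + cos t * b) * r"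
    unfolding cs by (simp_all only:)
  hence "c = cos t * a - sin t * b" "e = sin t * a + cos t * b"
    using r by simp_all
  with t(1,2) show ?thesis using that by blast
qed

text \<open>Rotations preserve each \<open>weight\<close>; conversely, equal weights allow an angle
  to be chosen separately for each index.\<close>

lemma same_orbit_iff:
  assumes x: "(d1, v1) \<in> Theta n" and y: "(d2, v2) \<in> Theta n"
  shows "(d2, v2) \<in> orbit (sym_torus_group n) (Gam n) (d1, v1) \<longleftrightarrow>
    (\<exists>\<sigma>. \<sigma> permutes {..<n} \<and> (\<forall>i<n. d2 $ i = d1 $ \<sigma> i \<and> weight n v2 i = weight n v1 (\<sigma> i)))"
    (is "?lhs \<longleftrightarrow> ?rhs")
proof
  assume ?lhs
  then obtain \<sigma> \<theta> where \<sigma>: "\<sigma> permutes {..<n}" and eq: "(d2, v2) = Gam n (\<sigma>, \<theta>) (d1, v1)"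
    by (auto simp: orbit_def sym_torus_group_def semidirect_prod_def perm_group_def)
  \<comment> \<open>With \<open>p = cos t\<close> and \<open>q = sin t\<close> the factor
    \<open>p^2 + q^2\<close> becomes 1.\<close>
  have "(p * a - q * b)\<^sup>2 + (q * a + p * b)\<^sup>2 = (p\<^sup>2 + q\<^sup>2) * (a\<^sup>2 + b\<^sup>2)" for p q a b :: real
    by (simp add: power2_eq_square algebra_simps)
  hence rot: "(cos t * a - sin t * b)\<^sup>2 + (sin t * a + cos t * b)\<^sup>2 = a\<^sup>2 + b\<^sup>2" for t a b :: real
    by simp
  have "d2 $ i = d1 $ \<sigma> i \<and> weight n v2 i = weight n v1 (\<sigma> i)" if "i < n" for i
    using eq that unfolding Gam_apply[OF \<sigma> x] by (simp add: weight_def rot)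
  thus ?rhs using \<sigma> by blast
next
  assume ?rhs
  then obtain \<sigma> where \<sigma>: "\<sigma> permutes {..<n}" and d: "\<And>i. i < n \<Longrightarrow> d2 $ i = d1 $ \<sigma> i"
    and w: "\<And>i. i < n \<Longrightarrow> weight n v2 i = weight n v1 (\<sigma> i)" by blast
  have "\<exists>t. 0 \<le> t \<and> t < 2 * pi \<and> v2 $ i = cos t * v1 $ \<sigma> i - sin t * v1 $ (n + \<sigma> i) \<and>
      v2 $ (n + i) = sin t * v1 $ \<sigma> i + cos t * v1 $ (n + \<sigma> i)" if "i < n" for i
    using rotation_exists[OF w[OF that, unfolded weight_def]] by metis
  then obtain t where t: "\<And>i. i < n \<Longrightarrow> 0 \<le> t i \<and> t i < 2 * pi \<and>
      v2 $ i = cos (t i) * v1 $ \<sigma> i - sin (t i) * v1 $ (n + \<sigma> i) \<and>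
      v2 $ (n + i) = sin (t i) * v1 $ \<sigma> i + cos (t i) * v1 $ (n + \<sigma> i)"
    by metis
  have "v2 $ i = (if i < n then cos (t i) * v1 $ \<sigma> i - sin (t i) * v1 $ (n + \<sigma> i)
      else sin (t (i - n)) * v1 $ \<sigma> (i - n) + cos (t (i - n)) * v1 $ (n + \<sigma> (i - n)))"
    if "i < 2 * n" for i
    using t[of i] t[of "i - n"] that by auto
  hence "Gam n (\<sigma>, vec n t) (d1, v1) = (d2, v2)"
    using y d unfolding Gam_apply[OF \<sigma> x] by (auto simp: Theta_def intro!: eq_vecI)
  moreover have "(\<sigma>, vec n t) \<in> carrier (sym_torus_group n)"
    using \<sigma> t by (simp add: sym_torus_group_def semidirect_prod_def perm_group_def torus_group_def)
  ultimately show ?lhs unfolding orbit_def by force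
qed

text \<open>Passes from a common orbit of some base point \<open>z\<close> to the orbit of
  \<open>x\<close>, using symmetry and transitivity.\<close>

lemma (in group_action) in_common_orbit_iff:
  assumes x: "x \<in> E" and y: "y \<in> E"
  shows "(\<exists>orb \<in> orbits G E \<phi>. x \<in> orb \<and> y \<in> orb) \<longleftrightarrow> y \<in> orbit G \<phi> x"
proof
  assume "\<exists>orb \<in> orbits G E \<phi>. x \<in> orb \<and> y \<in> orb"
  then obtain z where z: "z \<in> E" "x \<in> orbit G \<phi> z" "y \<in> orbit G \<phi> z"
    by (auto simp: orbits_def)
  show "y \<in> orbit G \<phi> x"
    by (rule orbit_trans[OF x z(1) y orbit_sym[OF z(1) x z(2)] z(3)])
qed (use x orbit_refl in \<open>auto simp: orbits_def\<close>)

theorem proposition4p19: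
  fixes n :: nat and d1 v1 d2 v2 :: "real vec"
  assumes "n \<ge> 1"
    and "(d1, v1) \<in> Theta_can n"
    and "(d2, v2) \<in> Theta_can n"
  shows "sys_equiv n (d1, v1) (d2, v2) \<longleftrightarrow>
    (\<exists>orb \<in> orbits (sym_torus_group n) (Theta n) (Gam n). (d1, v1) \<in> orb \<and> (d2, v2) \<in> orb)"
proof -
  have x: "(d1, v1) \<in> Theta n" and y: "(d2, v2) \<in> Theta n"
    and inj: "inj_on (\<lambda>i. d1 $ i) {..<n}" "inj_on (\<lambda>i. d2 $ i) {..<n}"
    using assms by (auto simp: Theta_can_def)
  hence v: "v1 \<in> carrier_vec (2 * n)" "v2 \<in> carrier_vec (2 * n)"
    and pos: "\<And>i. i < n \<Longrightarrow> d1 $ i > 0" "\<And>i. i < n \<Longrightarrow> d2 $ i > 0"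
    by (auto simp: Theta_def)
  have "sys_equiv n (d1, v1) (d2, v2) \<longleftrightarrow>
      (d2, v2) \<in> orbit (sym_torus_group n) (Gam n) (d1, v1)"
    \<comment> \<open>Equivalence becomes equality of denominators and numerators, and the orbit
      condition becomes the existence of a permutation matching entries and weights.\<close>
    unfolding sys_equiv_iff_eq g1_ctr_eq_iff[OF assms(1)] g2_ctr_eq_iff[OF v] same_orbit_iff[OF x y]
    by (rule transfer_eq_iff_perm) (use pos inj in auto)
  thus ?thesis
    unfolding group_action.in_common_orbit_iff[OF group_action_Gam x y] .
qed

end
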